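(* Let $R$ be an integral domain, let $\mathbf{m}$ be a maximal ideal of the polynomial ring $R[X]$, and put $\wp=\mathbf{m}\cap R$, a prime ideal of $R$. Then $\mathbf{m}$ is power stable if and only if $\wp^{(t)}=\wp^t$ for all $t\geq 1$, i.e., if and only if $\wp^t$ is $\wp$-primary for all $t\geq 1$.
   Context: All rings are commutative with identity. An ideal $I$ of $R[X]$ is called power stable if $I^t\cap R=(I\cap R)^t$ for all $t\geq 1$. For a prime ideal $\wp$ of $R$, $\wp^{(t)}=\wp^tR_\wp\cap R$ denotes the $t$-th symbolic power of $\wp$. *)

theory Defs
  imports "HOL-Algebra.Algebraic_Closure_Type" "HOL-Algebra.Ideal_Product"
begin

text \<open>
  The ring \<open>R\<close> is a type \<open>'a\<close> of class \<^class>\<open>comm_ring_1\<close> or \<^class>\<open>idom\<close> and \<open>R[X]\<close> is the type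
  \<open>'a poly\<close>. The ideal theory of HOL-Algebra is applied to the ring structure that
  \<^const>\<open>ring_of_type_algebra\<close> puts on such a type.
\<close>

definition ideal_pow :: "('a, 'b) ring_scheme \<Rightarrow> 'a set \<Rightarrow> nat \<Rightarrow> 'a set"
  where "ideal_pow R I t = I [^]\<^bsub>ideals_set R\<^esub> t"

definition contraction :: "'a::comm_ring_1 poly set \<Rightarrow> 'a set"
  where "contraction I = {r. [:r:] \<in> I}"

definition power_stable :: "'a::comm_ring_1 poly set \<Rightarrow> bool"
  where "power_stable I \<longleftrightarrow>
    (\<forall>t\<ge>1. contraction (ideal_pow ring_of_type_algebra I t)
            = ideal_pow ring_of_type_algebra (contraction I) t)"

text \<open>
  For a prime ideal \<open>P\<close> of a domain, the localization \<open>R\<^sub>P\<close> is the subring of the fraction field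
  consisting of the fractions with denominator outside \<open>P\<close>.
\<close>

definition localization_at :: "'a::idom set \<Rightarrow> 'a fract ring"
  where "localization_at P =
    ring_of_type_algebra\<lparr>carrier := {Fraction_Field.Fract a s | a s. s \<notin> P}\<rparr>"

definition symbolic_power :: "'a::idom set \<Rightarrow> nat \<Rightarrow> 'a set"
  where "symbolic_power P t =
    {r. Fraction_Field.Fract r 1 \<in>
          Idl\<^bsub>localization_at P\<^esub>
            ((\<lambda>a. Fraction_Field.Fract a 1) ` ideal_pow ring_of_type_algebra P t)}"

definition ideal_radical :: "('a, 'b) ring_scheme \<Rightarrow> 'a set \<Rightarrow> 'a set"
  where "ideal_radical R I = {x \<in> carrier R. \<exists>n::nat. n \<ge> 1 \<and> x [^]\<^bsub>R\<^esub> n \<in> I}"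

definition primary_ideal :: "('a, 'b) ring_scheme \<Rightarrow> 'a set \<Rightarrow> bool"
  where "primary_ideal R Q \<longleftrightarrow>
    ideal Q R \<and> Q \<noteq> carrier R \<and>
    (\<forall>a\<in>carrier R. \<forall>b\<in>carrier R. a \<otimes>\<^bsub>R\<^esub> b \<in> Q \<longrightarrow> a \<in> Q \<or> b \<in> ideal_radical R Q)"

definition primary_to :: "('a, 'b) ring_scheme \<Rightarrow> 'a set \<Rightarrow> 'a set \<Rightarrow> bool"
  where "primary_to R P Q \<longleftrightarrow> primary_ideal R Q \<and> ideal_radical R Q = P"

text \<open>The structure \<^const>\<open>localization_at\<close> is indeed a ring, so that the ideals it generates in the
  definition of \<^const>\<open>symbolic_power\<close> are meaningful.\<close>

lemma cring_localization_at:
  fixes P :: "'a::idom set"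
  assumes "primeideal P ring_of_type_algebra"
  shows "cring (localization_at P)"
proof -
  interpret P: primeideal P "ring_of_type_algebra :: 'a ring" by fact
  have z: "0 \<in> P"
    using additive_subgroup.zero_closed[OF P.is_additive_subgroup] by (simp add: ring_of_type_algebra_def)
  have one: "1 \<notin> P"
    using P.one_imp_carrier P.I_notcarr by (auto simp: ring_of_type_algebra_def)
  have mul: "s * t \<notin> P" if "s \<notin> P" "t \<notin> P" for s t
    using P.I_prime[of s t] that by (auto simp: ring_of_type_algebra_def)
  define L where "L = {Fraction_Field.Fract a s | a s. s \<notin> P}"
  have nz: "s \<noteq> 0" if "s \<notin> P" for s using that z by auto
  have 1: "x + y \<in> L" if "x \<in> L" "y \<in> L" for x y
    using that mul nz unfolding L_def by (force simp: add_fract)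
  have 2: "x * y \<in> L" if "x \<in> L" "y \<in> L" for x y
    using that mul unfolding L_def by force
  have 3: "- x \<in> L" if "x \<in> L" for x
    using that unfolding L_def by force
  have 4: "0 \<in> L" "1 \<in> L"
    using one unfolding L_def by (auto simp: Zero_fract_def One_fract_def)
  have ex: "\<exists>y\<in>L. y + x = 0" if "x \<in> L" for x
    using 3[OF that] by (intro bexI[of _ "- x"]) auto
  show ?thesis
    unfolding localization_at_def L_def[symmetric]
    by (rule cringI, rule abelian_groupI, goal_cases)
       (use 1 2 4 ex in \<open>auto simp: ring_of_type_algebra_def algebra_simps
          intro!: comm_monoidI\<close>)
qed

end

theory Submission
  imports Defs
begin

text \<open>
  Powers of a maximal ideal \<open>m\<close> are \<open>m\<close>-primary, and contraction preserves this; so if \<open>m\<close> is power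
  stable, the powers of \<open>P\<close> are \<open>P\<close>-primary. Conversely, choose \<open>f \<in> m\<close> of least degree among the
  elements whose leading coefficient lies outside \<open>P\<close>. Pseudo-division by \<open>f\<close> shows that each \<open>g \<in> m\<close>
  has a multiple \<open>s g\<close> with \<open>s \<notin> P\<close> in \<open>(f) + P[X]\<close>, hence each \<open>g \<in> m\<^sup>t\<close> has one in
  \<open>(f) + P\<^sup>t[X]\<close>. If \<open>g\<close> is a constant \<open>r\<close>, one more pseudo-division by \<open>f\<close>, whose degree is positive,
  leaves a remainder in \<open>P\<^sup>t[X]\<close> that equals \<open>s' r\<close> with \<open>s' \<notin> P\<close>. So \<open>r\<close> lies in the symbolic power.
\<close>

section \<open>Ideals of type class rings\<close>

lemma ring_of_type_algebra_sel [simp]: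
  "carrier ring_of_type_algebra = UNIV"
  "x \<otimes>\<^bsub>ring_of_type_algebra\<^esub> y = x * y"
  "x \<oplus>\<^bsub>ring_of_type_algebra\<^esub> y = x + y"
  "\<one>\<^bsub>ring_of_type_algebra\<^esub> = 1"
  "\<zero>\<^bsub>ring_of_type_algebra\<^esub> = 0"
  by (simp_all add: ring_of_type_algebra_def)

lemma nat_pow_ring_of_type_algebra [simp]:
  "(x::'a::comm_ring_1) [^]\<^bsub>ring_of_type_algebra\<^esub> (n::nat) = x ^ n"
  by (induction n) (simp_all add: nat_pow_def mult.commute)

text \<open>Closure under negation comes for free, being multiplication by -1. The characterization
  turns facts about ideals into statements about the type class operations.\<close>

lemma ideal_ring_of_type_algebra_iff:
  fixes I :: "'a::comm_ring_1 set"
  shows "ideal I ring_of_type_algebra \<longleftrightarrow>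
    0 \<in> I \<and> (\<forall>a\<in>I. \<forall>b\<in>I. a + b \<in> I) \<and> (\<forall>a\<in>I. \<forall>x. x * a \<in> I)"
    (is "_ \<longleftrightarrow> ?rhs")
proof
  assume "ideal I ring_of_type_algebra"
  then interpret ideal I "ring_of_type_algebra :: 'a ring" .
  show ?rhs
    using additive_subgroup.zero_closed[OF is_additive_subgroup]
      additive_subgroup.a_closed[OF is_additive_subgroup] I_l_closed by simp
next
  assume rhs: ?rhs
  interpret ring "ring_of_type_algebra :: 'a ring"
    by (rule ring_from_type_algebra)
  have minus: "\<ominus>\<^bsub>ring_of_type_algebra\<^esub> x = - x" for x :: 'a
    by (rule minus_equality) simp_all
  show "ideal I ring_of_type_algebra"
  proof (rule idealI)
    show "subgroup I (add_monoid ring_of_type_algebra)"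
    proof (rule add.subgroupI)
      fix a assume "a \<in> I"
      then have "- 1 * a \<in> I"
        using rhs by blast
      then show "\<ominus>\<^bsub>ring_of_type_algebra\<^esub> a \<in> I"
        by (simp add: minus)
    qed (use rhs in auto)
  qed (use rhs ring_axioms in \<open>auto simp: mult.commute\<close>)
qed

lemma ideal_sum_closed:
  fixes I :: "'a::comm_ring_1 set"
  assumes "ideal I ring_of_type_algebra" "\<And>x. x \<in> A \<Longrightarrow> f x \<in> I"
  shows "sum f A \<in> I"
  using assms(2)
  by (induction A rule: infinite_finite_induct)
     (use assms(1) in \<open>auto simp: ideal_ring_of_type_algebra_iff\<close>)

lemma ideal_diff_closed:
  fixes I :: "'a::comm_ring_1 set"
  assumes "ideal I ring_of_type_algebra" "a \<in> I" "b \<in> I"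
  shows "a - b \<in> I"
proof -
  have "- 1 * b \<in> I"
    using assms unfolding ideal_ring_of_type_algebra_iff by blast
  then have "a + - 1 * b \<in> I"
    using assms unfolding ideal_ring_of_type_algebra_iff by blast
  then show ?thesis by simp
qed

section \<open>Powers of an ideal\<close>

lemma ideal_pow_0 [simp]: "ideal_pow R I 0 = carrier R"
  by (simp add: ideal_pow_def nat_pow_def ideals_set_def)

lemma ideal_pow_Suc: "ideal_pow R I (Suc t) = ideal_prod R (ideal_pow R I t) I"
  by (simp add: ideal_pow_def nat_pow_def ideals_set_def)

lemma (in ring) ideal_ideal_pow:
  assumes "ideal I R"
  shows "ideal (ideal_pow R I t) R"
  by (induction t) (simp_all add: oneideal ideal_pow_Suc ideal_prod_is_ideal assms)

lemma ideal_ideal_pow_type [intro]: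
  fixes I :: "'a::comm_ring_1 set"
  assumes "ideal I ring_of_type_algebra"
  shows "ideal (ideal_pow ring_of_type_algebra I t) ring_of_type_algebra"
  using assms by (rule ring.ideal_ideal_pow[OF ring_from_type_algebra])

lemma ideal_pow_mult:
  fixes I :: "'a::comm_ring_1 set"
  assumes "a \<in> ideal_pow ring_of_type_algebra I t" "b \<in> I"
  shows "a * b \<in> ideal_pow ring_of_type_algebra I (Suc t)"
  using ideal_prod.prod[OF assms, of ring_of_type_algebra] by (simp add: ideal_pow_Suc)

text \<open>The power with exponent t + 1 consists of sums of products of an element of the t-th
  power with an element of \<open>I\<close>. The predicate depends on the exponent because products
  raise it by one.\<close>

lemma ideal_pow_induct [consumes 1, case_names zero mult add]:
  fixes I :: "'a::comm_ring_1 set"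
  assumes "x \<in> ideal_pow ring_of_type_algebra I t"
    and "\<And>x. Q 0 x"
    and "\<And>t a b. \<lbrakk>Q t a; b \<in> I\<rbrakk> \<Longrightarrow> Q (Suc t) (a * b)"
    and "\<And>t a b. \<lbrakk>Q t a; Q t b\<rbrakk> \<Longrightarrow> Q t (a + b)"
  shows "Q t x"
  using assms(1)
proof (induction t arbitrary: x)
  case 0
  show ?case by (rule assms(2))
next
  case (Suc t)
  from Suc.prems[unfolded ideal_pow_Suc] show ?case
    by induction (use Suc.IH assms(3,4) in auto)
qed

lemma power_in_ideal_pow:
  fixes I :: "'a::comm_ring_1 set"
  assumes "a \<in> I"
  shows "a ^ t \<in> ideal_pow ring_of_type_algebra I t"
proof (induction t)
  case (Suc t)
  then show ?case
    using ideal_pow_mult[OF Suc assms] by (simp add: mult.commute)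
qed simp

lemma ideal_pow_subset:
  fixes I :: "'a::comm_ring_1 set"
  assumes "ideal I ring_of_type_algebra" "t \<ge> 1"
  shows "ideal_pow ring_of_type_algebra I t \<subseteq> I"
proof
  fix x assume "x \<in> ideal_pow ring_of_type_algebra I t"
  \<comment> \<open>The guard makes exponent 0 vacuous, where the power is the whole ring.\<close>
  then have "t \<ge> 1 \<longrightarrow> x \<in> I"
    by (induction rule: ideal_pow_induct)
       (use assms(1) in \<open>auto simp: ideal_ring_of_type_algebra_iff\<close>)
  with assms(2) show "x \<in> I" by blast
qed

section \<open>Prime ideals and primary powers\<close>

lemma primeideal_type_iff:
  fixes P :: "'a::comm_ring_1 set"
  shows "primeideal P ring_of_type_algebra \<longleftrightarrow>
    ideal P ring_of_type_algebra \<and> 1 \<notin> P \<and> (\<forall>a b. a * b \<in> P \<longrightarrow> a \<in> P \<or> b \<in> P)"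
proof
  assume "primeideal P ring_of_type_algebra"
  then interpret primeideal P "ring_of_type_algebra :: 'a ring" .
  show "ideal P ring_of_type_algebra \<and> 1 \<notin> P \<and> (\<forall>a b. a * b \<in> P \<longrightarrow> a \<in> P \<or> b \<in> P)"
    using is_ideal I_prime one_imp_carrier I_notcarr by auto
next
  assume "ideal P ring_of_type_algebra \<and> 1 \<notin> P \<and> (\<forall>a b. a * b \<in> P \<longrightarrow> a \<in> P \<or> b \<in> P)"
  then show "primeideal P ring_of_type_algebra"
    by (intro primeidealI cring_from_type_algebra) auto
qed

lemma primeideal_power:
  fixes P :: "'a::comm_ring_1 set"
  assumes "primeideal P ring_of_type_algebra" "a ^ n \<in> P"
  shows "a \<in> P"
  using assms(2) by (induction n) (use assms(1) in \<open>auto simp: primeideal_type_iff\<close>)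

lemma ideal_radical_ideal_pow:
  fixes P :: "'a::comm_ring_1 set"
  assumes "primeideal P ring_of_type_algebra" "t \<ge> 1"
  shows "ideal_radical ring_of_type_algebra (ideal_pow ring_of_type_algebra P t) = P"
proof -
  have "ideal_pow ring_of_type_algebra P t \<subseteq> P"
    using assms by (intro ideal_pow_subset) (auto simp: primeideal_type_iff)
  then show ?thesis
    using assms primeideal_power[OF assms(1)] power_in_ideal_pow[of _ P t]
    unfolding ideal_radical_def by auto
qed

text \<open>Since the radical of P^t is P, being P-primary amounts to cancelling factors outside P.
  This cancellation property is the common form to which all conditions of the theorem are
  reduced.\<close>

lemma primary_to_ideal_pow_iff:
  fixes P :: "'a::comm_ring_1 set"
  assumes "primeideal P ring_of_type_algebra" "t \<ge> 1"
  shows "primary_to ring_of_type_algebra P (ideal_pow ring_of_type_algebra P t) \<longleftrightarrow>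
    (\<forall>r s. s \<notin> P \<longrightarrow> s * r \<in> ideal_pow ring_of_type_algebra P t
       \<longrightarrow> r \<in> ideal_pow ring_of_type_algebra P t)"
proof -
  have P: "ideal P ring_of_type_algebra" "1 \<notin> P"
    using assms(1) by (auto simp: primeideal_type_iff)
  have "1 \<notin> ideal_pow ring_of_type_algebra P t"
    using ideal_pow_subset[OF P(1) assms(2)] P(2) by blast
  then show ?thesis
    using P unfolding primary_to_def primary_ideal_def ideal_radical_ideal_pow[OF assms]
    by (auto simp: mult.commute)
qed

section \<open>Symbolic powers\<close>

text \<open>The extension of P^t to the localization consists of the fractions with numerator in P^t
  and denominator outside P; contracting it means clearing one denominator.\<close>

lemma symbolic_power_eq:
  fixes P :: "'a::idom set"
  assumes P: "primeideal P ring_of_type_algebra"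
  shows "symbolic_power P t = {r. \<exists>s. s \<notin> P \<and> s * r \<in> ideal_pow ring_of_type_algebra P t}"
proof -
  define J where "J = ideal_pow ring_of_type_algebra P t"
  define L where "L = localization_at P"
  \<comment> \<open>\<open>K\<close> is the explicit form of the extended ideal: it is shown to be
    an ideal of \<open>L\<close>, and then to be the one generated by the image of
    \<open>J\<close>.\<close>
  define K where "K = {Fraction_Field.Fract a s | a s. a \<in> J \<and> s \<notin> P}"
  have P': "0 \<in> P" "1 \<notin> P" "\<And>a b. a * b \<in> P \<Longrightarrow> a \<in> P \<or> b \<in> P"
    using P by (auto simp: primeideal_type_iff ideal_ring_of_type_algebra_iff)
  have nz: "s \<noteq> 0" if "s \<notin> P" for s
    using that P'(1) by blast
  have "ideal J ring_of_type_algebra"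
    unfolding J_def using P by (auto simp: primeideal_type_iff)
  then have J: "0 \<in> J" "\<And>a b. \<lbrakk>a \<in> J; b \<in> J\<rbrakk> \<Longrightarrow> a + b \<in> J" "\<And>a x. a \<in> J \<Longrightarrow> x * a \<in> J"
    by (auto simp: ideal_ring_of_type_algebra_iff)
  interpret L: cring L
    unfolding L_def using P by (rule cring_localization_at)
  have L: "carrier L = {Fraction_Field.Fract a s | a s. s \<notin> P}"
    "x \<otimes>\<^bsub>L\<^esub> y = x * y" "x \<oplus>\<^bsub>L\<^esub> y = x + y" "\<one>\<^bsub>L\<^esub> = 1" "\<zero>\<^bsub>L\<^esub> = 0" for x y
    by (simp_all add: L_def localization_at_def ring_of_type_algebra_def)
  have minus: "\<ominus>\<^bsub>L\<^esub> x = - x" if "x \<in> carrier L" for x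
  proof (rule L.minus_equality)
    show "- x \<in> carrier L"
      using that unfolding L by force
  qed (use that in \<open>simp_all add: L\<close>)
  have KL: "K \<subseteq> carrier L"
    unfolding K_def L by blast
  have K_mult: "x * y \<in> K" if x: "x \<in> carrier L" and y: "y \<in> K" for x y
  proof -
    obtain b u a s where "x = Fraction_Field.Fract b u" "u \<notin> P"
      "y = Fraction_Field.Fract a s" "a \<in> J" "s \<notin> P"
      using x y unfolding L K_def by blast
    moreover from this have "x * y = Fraction_Field.Fract (b * a) (u * s)" "b * a \<in> J" "u * s \<notin> P"
      using J(3) P'(3) by auto
    ultimately show ?thesis
      unfolding K_def by blast
  qed
  have K_add: "x + y \<in> K" if x: "x \<in> K" and y: "y \<in> K" for x y
  proof -
    obtain b u a s where *: "x = Fraction_Field.Fract b u" "b \<in> J" "u \<notin> P"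
      "y = Fraction_Field.Fract a s" "a \<in> J" "s \<notin> P"
      using x y unfolding K_def by blast
    have "b * s + a * u \<in> J"
      using J(2)[OF J(3)[OF *(2), of s] J(3)[OF *(5), of u]] by (simp add: mult.commute)
    moreover have "x + y = Fraction_Field.Fract (b * s + a * u) (u * s)"
      using * nz by (simp add: add_fract)
    ultimately show ?thesis
      unfolding K_def using * P'(3) by blast
  qed
  have K_ideal: "ideal K L"
  proof (rule idealI[OF L.ring_axioms])
    show "subgroup K (add_monoid L)"
    proof (rule L.add.subgroupI)
      show "K \<noteq> {}"
        using J(1) P'(2) unfolding K_def by blast
      fix a assume a: "a \<in> K"
      have "- 1 \<in> carrier L"
        using minus[of 1] L.a_inv_closed[of 1] L.one_closed L(4) by metis
      from K_mult[OF this a] show "\<ominus>\<^bsub>L\<^esub> a \<in> K"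
        using minus a KL by auto
    next
      fix a b assume "a \<in> K" "b \<in> K"
      then show "a \<oplus>\<^bsub>L\<^esub> b \<in> K"
        by (simp add: L K_add)
    qed (rule KL)
  next
    fix a x assume "a \<in> K" "x \<in> carrier L"
    then show "x \<otimes>\<^bsub>L\<^esub> a \<in> K" "a \<otimes>\<^bsub>L\<^esub> x \<in> K"
      using K_mult[of x a] by (simp_all add: L(2) mult.commute[of a x])
  qed
  let ?\<iota> = "\<lambda>a. Fraction_Field.Fract a 1 :: 'a fract"
  have gen: "Idl\<^bsub>L\<^esub> (?\<iota> ` J) = K"
  proof
    show "Idl\<^bsub>L\<^esub> (?\<iota> ` J) \<subseteq> K"
      using P'(2) by (intro L.genideal_minimal K_ideal) (auto simp: K_def)
    have sub: "?\<iota> ` J \<subseteq> carrier L"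
      using P'(2) unfolding L by blast
    show "K \<subseteq> Idl\<^bsub>L\<^esub> (?\<iota> ` J)"
    proof
      fix x assume "x \<in> K"
      then obtain a s where x: "x = Fraction_Field.Fract a s" and a: "a \<in> J" and s: "s \<notin> P"
        unfolding K_def by blast
      have "?\<iota> a \<in> Idl\<^bsub>L\<^esub> (?\<iota> ` J)"
        using L.genideal_self[OF sub] a by blast
      \<comment> \<open>The fraction a/s is the multiple of the generator a/1 by 1/s.\<close>
      moreover have "Fraction_Field.Fract 1 s \<in> carrier L"
        using s unfolding L by blast
      ultimately have "Fraction_Field.Fract 1 s \<otimes>\<^bsub>L\<^esub> ?\<iota> a \<in> Idl\<^bsub>L\<^esub> (?\<iota> ` J)"
        using ideal.I_l_closed[OF L.genideal_ideal[OF sub]] by blast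
      then show "x \<in> Idl\<^bsub>L\<^esub> (?\<iota> ` J)"
        by (simp add: L x)
    qed
  qed
  have "?\<iota> r \<in> K \<longleftrightarrow> (\<exists>s. s \<notin> P \<and> s * r \<in> J)" for r
  proof
    assume "?\<iota> r \<in> K"
    then obtain a s where "?\<iota> r = Fraction_Field.Fract a s" "a \<in> J" "s \<notin> P"
      unfolding K_def by blast
    then show "\<exists>s. s \<notin> P \<and> s * r \<in> J"
      using nz by (intro exI[of _ s]) (simp add: eq_fract mult.commute)
  next
    assume "\<exists>s. s \<notin> P \<and> s * r \<in> J"
    then obtain s where s: "s \<notin> P" "s * r \<in> J" by blast
    then have "?\<iota> r = Fraction_Field.Fract (s * r) s"
      using nz by (simp add: eq_fract)
    with s show "?\<iota> r \<in> K"
      unfolding K_def by blast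
  qed
  then show ?thesis
    unfolding symbolic_power_def J_def[symmetric] L_def[symmetric] gen by blast
qed

section \<open>Polynomials with coefficients in an ideal\<close>

text \<open>For an ideal \<open>I\<close> this is the extended ideal I[X], described by coefficients
  so that membership of a constant or of a leading coefficient can be read off directly.\<close>

definition coeff_ideal :: "'a::comm_ring_1 set \<Rightarrow> 'a poly set"
  where "coeff_ideal I = {p. \<forall>i. coeff p i \<in> I}"

lemma ideal_coeff_ideal:
  fixes I :: "'a::comm_ring_1 set"
  assumes "ideal I ring_of_type_algebra"
  shows "ideal (coeff_ideal I) ring_of_type_algebra"
  unfolding ideal_ring_of_type_algebra_iff
proof (intro conjI ballI allI)
  fix p q assume "p \<in> coeff_ideal I"
  then show "q * p \<in> coeff_ideal I"
    using assms unfolding coeff_ideal_def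
    by (auto simp: coeff_mult ideal_ring_of_type_algebra_iff intro!: ideal_sum_closed[OF assms])
qed (use assms in \<open>auto simp: coeff_ideal_def ideal_ring_of_type_algebra_iff\<close>)

lemma coeff_ideal_pow_mult:
  fixes I :: "'a::comm_ring_1 set"
  assumes "ideal I ring_of_type_algebra"
    and "p \<in> coeff_ideal (ideal_pow ring_of_type_algebra I t)" "q \<in> coeff_ideal I"
  shows "p * q \<in> coeff_ideal (ideal_pow ring_of_type_algebra I (Suc t))"
  using assms unfolding coeff_ideal_def
  by (auto simp: coeff_mult intro!: ideal_sum_closed ideal_pow_mult)

text \<open>Such a polynomial is the sum of its monomials, and each is a multiple of a constant
  lying in \<open>m\<close>.\<close>

lemma coeff_ideal_subset_contraction:
  fixes m :: "'a::comm_ring_1 poly set"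
  assumes m: "ideal m ring_of_type_algebra"
  shows "coeff_ideal (contraction m) \<subseteq> m"
proof
  fix p assume p: "p \<in> coeff_ideal (contraction m)"
  have "monom (coeff p i) i \<in> m" for i
  proof -
    have "monom 1 i * [:coeff p i:] \<in> m"
      using m p unfolding ideal_ring_of_type_algebra_iff coeff_ideal_def contraction_def by blast
    then show ?thesis
      by (simp add: mult.commute[of "monom 1 i"] smult_monom)
  qed
  then have "(\<Sum>i\<le>degree p. monom (coeff p i) i) \<in> m"
    by (intro ideal_sum_closed[OF m])
  then show "p \<in> m"
    by (simp add: poly_as_sum_of_monoms)
qed

text \<open>Every division step subtracts a multiple of \<open>f\<close> by a monomial whose
  coefficient is a coefficient of the dividend, so the process never leaves I[X].\<close>

lemma pseudo_division_coeff_ideal: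
  fixes f p :: "'a::idom poly"
  assumes I: "ideal I ring_of_type_algebra" and f: "degree f > 0"
    and p: "p \<in> coeff_ideal I"
  shows "\<exists>k q r. smult (lead_coeff f ^ k) p = q * f + r \<and> degree r < degree f \<and> r \<in> coeff_ideal I"
  using p
proof (induction "degree p" arbitrary: p rule: less_induct)
  case less
  show ?case
  proof (cases "degree p < degree f")
    case True
    then show ?thesis
      using less.prems by (intro exI[of _ 0] exI[of _ 0] exI[of _ p]) simp
  next
    case False
    define u where "u = monom (lead_coeff p) (degree p - degree f)"
    \<comment> \<open>Both terms have the same coefficient at \<open>degree p\<close>, so the
      leading term cancels.\<close>
    define p' where "p' = smult (lead_coeff f) p - u * f"
    have CI: "ideal (coeff_ideal I) ring_of_type_algebra"
      using I by (rule ideal_coeff_ideal)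
    have "u \<in> coeff_ideal I"
      using less.prems I unfolding u_def coeff_ideal_def ideal_ring_of_type_algebra_iff by auto
    then have "f * u \<in> coeff_ideal I" "[:lead_coeff f:] * p \<in> coeff_ideal I"
      using CI less.prems unfolding ideal_ring_of_type_algebra_iff by blast+
    then have p': "p' \<in> coeff_ideal I"
      unfolding p'_def using ideal_diff_closed[OF CI] by (simp add: mult.commute)
    have "degree u \<le> degree p - degree f"
      unfolding u_def by (rule degree_monom_le)
    then have "degree (u * f) \<le> degree p"
      using degree_mult_le[of u f] False by linarith
    then have "degree p' \<le> degree p"
      unfolding p'_def by (intro degree_diff_le) simp_all
    moreover have "coeff p' (degree p) = 0"
      using False by (simp add: p'_def u_def coeff_monom_mult)
    \<comment> \<open>Without this, cancelling the leading term would not lower the degree.\<close>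
    moreover have "degree p > 0"
      using f False by linarith
    ultimately have "degree p' < degree p"
      by (metis leading_coeff_0_iff degree_0 le_neq_implies_less)
    from less.hyps[OF this p'] obtain k q r
      where *: "smult (lead_coeff f ^ k) p' = q * f + r" "degree r < degree f" "r \<in> coeff_ideal I"
      by blast
    have "smult (lead_coeff f ^ Suc k) p = smult (lead_coeff f ^ k) p' + smult (lead_coeff f ^ k) u * f"
      by (simp add: p'_def smult_diff_right mult.commute)
    also have "\<dots> = (q + smult (lead_coeff f ^ k) u) * f + r"
      by (simp add: * algebra_simps)
    finally show ?thesis
      using *(2,3) by blast
  qed
qed

lemma exists_lead_coeff_notin:
  fixes m :: "'a::comm_ring_1 poly set"
  assumes m: "ideal m ring_of_type_algebra"
    and "h \<in> m" "h \<notin> coeff_ideal (contraction m)"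
  shows "\<exists>g\<in>m. lead_coeff g \<notin> contraction m \<and> degree g \<le> degree h"
  using assms(2,3)
proof (induction "degree h" arbitrary: h rule: less_induct)
  case less
  show ?case
  proof (cases "lead_coeff h \<in> contraction m")
    case True
    define u where "u = monom (lead_coeff h) (degree h)"
    have CI: "0 \<in> contraction m"
      using m by (simp add: contraction_def ideal_ring_of_type_algebra_iff)
    have u: "u \<in> coeff_ideal (contraction m)"
      using True CI unfolding u_def coeff_ideal_def by auto
    then have hu: "h - u \<in> m"
      using coeff_ideal_subset_contraction[OF m] less.prems(1) by (intro ideal_diff_closed[OF m]) auto
    have eq: "coeff (h - u) i = (if i = degree h then 0 else coeff h i)" for i
      by (simp add: u_def)
    have hu': "h - u \<notin> coeff_ideal (contraction m)"
    proof
      assume "h - u \<in> coeff_ideal (contraction m)"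
      then have "coeff h i \<in> contraction m" for i
        using True eq[of i] unfolding coeff_ideal_def mem_Collect_eq by metis
      with less.prems(2) show False
        unfolding coeff_ideal_def by blast
    qed
    have "degree (h - u) \<le> degree h"
      unfolding u_def by (intro degree_diff_le degree_monom_le order_refl)
    moreover have "h - u \<noteq> 0"
      using hu' CI by (auto simp: coeff_ideal_def)
    ultimately have "degree (h - u) < degree h"
      by (metis eq le_neq_implies_less leading_coeff_0_iff)
    from less.hyps[OF this hu hu'] this show ?thesis
      by (meson less_imp_le order_trans)
  qed (use less.prems in blast)
qed

section \<open>Contractions of powers of maximal ideals\<close>

text \<open>The ideal \<open>J\<close> below is m + (b), which properly contains \<open>m\<close>
  and hence is the whole ring.\<close>

lemma maximalideal_comaximal:
  fixes m :: "'a::comm_ring_1 set"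
  assumes "maximalideal m ring_of_type_algebra" "b \<notin> m"
  obtains g where "1 - g * b \<in> m"
proof -
  interpret maximalideal m "ring_of_type_algebra :: 'a ring" by fact
  define J where "J = {x. \<exists>g. x - g * b \<in> m}"
  have m: "0 \<in> m" "\<And>x y. \<lbrakk>x \<in> m; y \<in> m\<rbrakk> \<Longrightarrow> x + y \<in> m" "\<And>x y. x \<in> m \<Longrightarrow> y * x \<in> m"
    using is_ideal unfolding ideal_ring_of_type_algebra_iff by auto
  have "ideal J ring_of_type_algebra"
    unfolding ideal_ring_of_type_algebra_iff
  proof (intro conjI ballI allI)
    show "0 \<in> J"
      unfolding J_def using m(1) by (auto intro: exI[of _ 0])
    fix x assume "x \<in> J"
    then obtain g where g: "x - g * b \<in> m"
      unfolding J_def by blast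
    {
      fix y assume "y \<in> J"
      then obtain h where h: "y - h * b \<in> m"
        unfolding J_def by blast
      have "(x + y) - (g + h) * b \<in> m"
        using m(2)[OF g h] by (simp add: algebra_simps)
      then show "x + y \<in> J"
        unfolding J_def by blast
    }
    fix y
    have "y * x - (y * g) * b \<in> m"
      using m(3)[OF g, of y] by (simp add: algebra_simps)
    then show "y * x \<in> J"
      unfolding J_def by blast
  qed
  moreover have "m \<subseteq> J"
    unfolding J_def by (auto intro: exI[of _ 0])
  moreover have "b \<in> J"
    unfolding J_def using m(1) by (auto intro: exI[of _ 1])
  ultimately have "J = UNIV"
    using I_maximal[of J] assms(2) by auto
  then have "1 \<in> J" by simp
  then show ?thesis
    unfolding J_def using that by blast
qed

text \<open>An element outside \<open>m\<close> is invertible modulo \<open>m\<close>, and therefore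
  modulo every power of \<open>m\<close>.\<close>

lemma maximalideal_pow_cancel:
  fixes m :: "'a::comm_ring_1 set"
  assumes max: "maximalideal m ring_of_type_algebra" and b: "b \<notin> m"
    and ba: "b * a \<in> ideal_pow ring_of_type_algebra m t"
  shows "a \<in> ideal_pow ring_of_type_algebra m t"
proof -
  let ?J = "ideal_pow ring_of_type_algebra m t"
  have J: "ideal ?J ring_of_type_algebra"
    using max by (intro ideal_ideal_pow_type) (auto simp: maximalideal_def)
  obtain g where g: "1 - g * b \<in> m"
    using maximalideal_comaximal[OF max b] .
  \<comment> \<open>The geometric sum in x = 1 - g b: multiplied by 1 - x = g b it gives 1 - x^t, so
    g c inverts b modulo the t-th power of \<open>m\<close>.\<close>
  define c where "c = (\<Sum>i<t. (1 - g * b) ^ i)"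
  have c: "1 - (1 - g * b) ^ t = g * b * c"
    unfolding c_def by (simp add: one_diff_power_eq)
  have "(g * c) * (b * a) \<in> ?J" "a * (1 - g * b) ^ t \<in> ?J"
    using J ba power_in_ideal_pow[OF g, of t] unfolding ideal_ring_of_type_algebra_iff by blast+
  then have "(g * c) * (b * a) + a * (1 - g * b) ^ t \<in> ?J"
    using J unfolding ideal_ring_of_type_algebra_iff by blast
  also have "(g * c) * (b * a) + a * (1 - g * b) ^ t = a * (g * b * c + (1 - g * b) ^ t)"
    by (simp add: algebra_simps)
  also have "\<dots> = a"
    by (simp flip: c)
  finally show ?thesis .
qed

section \<open>Contraction to the coefficient ring\<close>

lemma primeideal_contraction:
  fixes m :: "'a::comm_ring_1 poly set"
  assumes "primeideal m ring_of_type_algebra"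
  shows "primeideal (contraction m) ring_of_type_algebra"
proof -
  have "[:a * b:] = [:a:] * [:b:]" "[:a + b:] = [:a:] + [:b:]" for a b :: 'a
    by simp_all
  then show ?thesis
    using assms unfolding primeideal_type_iff ideal_ring_of_type_algebra_iff contraction_def
    by (auto simp only: mem_Collect_eq pCons_0_0 one_pCons)
qed

text \<open>Embedding the constants respects sums and products. So one inclusion of power stability
  holds for every ideal, and only the other is at stake.\<close>

lemma ideal_pow_contraction_subset:
  fixes m :: "'a::comm_ring_1 poly set"
  assumes "ideal m ring_of_type_algebra"
  shows "ideal_pow ring_of_type_algebra (contraction m) t
    \<subseteq> contraction (ideal_pow ring_of_type_algebra m t)"
proof
  fix x assume "x \<in> ideal_pow ring_of_type_algebra (contraction m) t"
  then have "[:x:] \<in> ideal_pow ring_of_type_algebra m t"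
  proof (induction rule: ideal_pow_induct)
    case (mult t a b)
    then have "[:a:] * [:b:] \<in> ideal_pow ring_of_type_algebra m (Suc t)"
      by (intro ideal_pow_mult) (simp_all add: contraction_def)
    then show ?case by (simp add: mult.commute)
  next
    case (add t a b)
    then have "[:a:] + [:b:] \<in> ideal_pow ring_of_type_algebra m t"
      using ideal_ideal_pow_type[OF assms, of t] unfolding ideal_ring_of_type_algebra_iff by blast
    then show ?case by simp
  qed simp
  then show "x \<in> contraction (ideal_pow ring_of_type_algebra m t)"
    by (simp add: contraction_def)
qed

text \<open>If all coefficients of elements of \<open>m\<close> lay in the contraction P, then X
  would be outside \<open>m\<close>, hence invertible modulo \<open>m\<close>. But 1 - g X has
  constant coefficient 1, which is not in P.\<close>

lemma maximalideal_not_extended: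
  fixes m :: "'a::comm_ring_1 poly set"
  assumes "maximalideal m ring_of_type_algebra"
  shows "\<not> m \<subseteq> coeff_ideal (contraction m)"
proof
  assume sub: "m \<subseteq> coeff_ideal (contraction m)"
  have prime: "primeideal (contraction m) ring_of_type_algebra"
    using cring.maximalideal_prime[OF cring_from_type_algebra assms] by (rule primeideal_contraction)
  then have one: "1 \<notin> contraction m"
    by (simp add: primeideal_type_iff)
  have "[:0, 1:] \<notin> m"
  proof
    assume "[:0, 1:] \<in> m"
    with sub have "coeff [:0, 1:] 1 \<in> contraction m"
      unfolding coeff_ideal_def by blast
    with one show False by simp
  qed
  then obtain g where "1 - g * [:0, 1:] \<in> m"
    using maximalideal_comaximal[OF assms] by blast
  with sub have "coeff (1 - g * [:0, 1:]) 0 \<in> contraction m"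
    unfolding coeff_ideal_def by blast
  with one show False
    by simp
qed

text \<open>In view of \<open>symbolic_power_eq\<close>, this places the contraction of the t-th
  power of \<open>m\<close> inside the t-th symbolic power of its contraction.\<close>

lemma contraction_maximalideal_pow:
  fixes m :: "'a::idom poly set"
  assumes max: "maximalideal m ring_of_type_algebra"
    and r: "r \<in> contraction (ideal_pow ring_of_type_algebra m t)"
  obtains s where "s \<notin> contraction m"
    "s * r \<in> ideal_pow ring_of_type_algebra (contraction m) t"
proof -
  define P where "P = contraction m"
  define Pw where "Pw = ideal_pow ring_of_type_algebra P"
  have m: "ideal m ring_of_type_algebra"
    using max by (simp add: maximalideal_def)
  have prime: "primeideal P ring_of_type_algebra"
    unfolding P_def using cring.maximalideal_prime[OF cring_from_type_algebra max]
    by (rule primeideal_contraction)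
  then have P: "ideal P ring_of_type_algebra" "1 \<notin> P" "\<And>a b. a * b \<in> P \<Longrightarrow> a \<in> P \<or> b \<in> P"
    by (auto simp: primeideal_type_iff)
  have Pw: "ideal (Pw t) ring_of_type_algebra" for t
    unfolding Pw_def using P(1) by blast
  have CPw: "ideal (coeff_ideal (Pw t)) ring_of_type_algebra" for t
    using Pw by (rule ideal_coeff_ideal)
  define good where "good = (\<lambda>g. g \<in> m \<and> lead_coeff g \<notin> P)"
  obtain h where "h \<in> m" "h \<notin> coeff_ideal P"
    using maximalideal_not_extended[OF max] unfolding P_def by blast
  then have "\<exists>g. good g"
    using exists_lead_coeff_notin[OF m, of h] unfolding good_def P_def by blast
  then obtain f where f: "good f" and min: "\<And>g. good g \<Longrightarrow> degree f \<le> degree g"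
    by (metis ex_has_least_nat[of good _ degree])
  define c where "c = lead_coeff f"
  have fm: "f \<in> m" and "c \<notin> P"
    using f by (simp_all add: good_def c_def)
  then have c: "c ^ k \<notin> P" for k
    using primeideal_power[OF prime] by blast
  \<comment> \<open>A constant \<open>f\<close> in \<open>m\<close> would put its own leading
    coefficient into P. Positive degree is used in both pseudo-divisions and in the final degree
    comparison.\<close>
  have f_deg: "degree f > 0"
  proof (rule ccontr)
    assume "\<not> degree f > 0"
    then have "f = [:c:]"
      unfolding c_def by (metis degree_0_id gr0I)
    with fm \<open>c \<notin> P\<close> show False
      by (simp add: P_def contraction_def)
  qed
  \<comment> \<open>Otherwise dropping leading terms from \<open>h\<close> would give a good element
    of smaller degree than \<open>f\<close>.\<close>
  have low: "h \<in> coeff_ideal P" if "h \<in> m" "degree h < degree f" for h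
    using exists_lead_coeff_notin[OF m, of h] min that unfolding good_def P_def
    by (meson leD order_le_less_trans)
  have m_red: "\<exists>s q p. s \<notin> P \<and> smult s g = q * f + p \<and> p \<in> coeff_ideal P" if "g \<in> m" for g
  proof -
    \<comment> \<open>The coefficients of \<open>g\<close> are arbitrary, so division is done over
      the unit ideal. That the remainder lies in P[X] follows instead from \<open>low\<close>, as it
      is in \<open>m\<close> and has degree below that of \<open>f\<close>.\<close>
    have "ideal (UNIV :: 'a set) ring_of_type_algebra" "g \<in> coeff_ideal UNIV"
      by (simp_all add: ideal_ring_of_type_algebra_iff coeff_ideal_def)
    from pseudo_division_coeff_ideal[OF this(1) f_deg this(2)] obtain k q p
      where *: "smult (c ^ k) g = q * f + p" "degree p < degree f"
      unfolding c_def by blast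
    have "[:c ^ k:] * g \<in> m" "q * f \<in> m"
      using m fm that unfolding ideal_ring_of_type_algebra_iff by blast+
    from ideal_diff_closed[OF m this] * have "p \<in> m"
      by simp
    then show ?thesis
      using c * low by blast
  qed
  have red: "\<exists>s q p. s \<notin> P \<and> smult s g = q * f + p \<and> p \<in> coeff_ideal (Pw t)"
    if "g \<in> ideal_pow ring_of_type_algebra m t" for g t
    using that
  proof (induction rule: ideal_pow_induct)
    case (zero g)
    show ?case
      using P(2) by (intro exI[of _ 1] exI[of _ 0] exI[of _ g]) (simp add: Pw_def coeff_ideal_def)
  next
    case (mult t a b)
    then obtain s q p s' q' p' where *: "s \<notin> P" "smult s a = q * f + p" "p \<in> coeff_ideal (Pw t)"
      "s' \<notin> P" "smult s' b = q' * f + p'" "p' \<in> coeff_ideal P"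
      using m_red[of b] by blast
    have "smult (s * s') (a * b) = smult s a * smult s' b"
      by (simp add: mult.commute)
    \<comment> \<open>Multiplying the two representations, every term except \<open>p * p'\<close>
      contains the factor \<open>f\<close>.\<close>
    also have "\<dots> = (q * q' * f + q * p' + p * q') * f + p * p'"
      by (simp add: * algebra_simps)
    finally have "smult (s * s') (a * b) = (q * q' * f + q * p' + p * q') * f + p * p'" .
    moreover have "p * p' \<in> coeff_ideal (Pw (Suc t))"
      using coeff_ideal_pow_mult[OF P(1)] * unfolding Pw_def by blast
    ultimately show ?case
      using P(3) * by blast
  next
    case (add t a b)
    then obtain s q p s' q' p' where *: "s \<notin> P" "smult s a = q * f + p" "p \<in> coeff_ideal (Pw t)"
      "s' \<notin> P" "smult s' b = q' * f + p'" "p' \<in> coeff_ideal (Pw t)"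
      by blast
    have "smult (s * s') (a + b) = smult s' (smult s a) + smult s (smult s' b)"
      by (simp add: smult_add_right mult.commute)
    also have "\<dots> = (smult s' q + smult s q') * f + ([:s':] * p + [:s:] * p')"
      unfolding * by (simp add: algebra_simps smult_add_right)
    finally have "smult (s * s') (a + b) = (smult s' q + smult s q') * f + ([:s':] * p + [:s:] * p')" .
    moreover have "[:s':] * p + [:s:] * p' \<in> coeff_ideal (Pw t)"
      using CPw[of t] * unfolding ideal_ring_of_type_algebra_iff by blast
    ultimately show ?case
      using P(3) * by blast
  qed
  obtain s q p where s: "s \<notin> P" and sr: "smult s [:r:] = q * f + p" and p: "p \<in> coeff_ideal (Pw t)"
    using red[of "[:r:]" t] r unfolding contraction_def by blast
  \<comment> \<open>The remainder \<open>p\<close> may have large degree. Dividing it by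
    \<open>f\<close> again bounds the degree and keeps the coefficients in P^t.\<close>
  obtain k q' p' where p': "smult (c ^ k) p = q' * f + p'" "degree p' < degree f"
    "p' \<in> coeff_ideal (Pw t)"
    using pseudo_division_coeff_ideal[OF Pw f_deg p] unfolding c_def by blast
  have "[:c ^ k * s * r:] = smult (c ^ k) (smult s [:r:])"
    by simp
  also have "\<dots> = (smult (c ^ k) q + q') * f + p'"
    unfolding sr by (simp add: smult_add_right p' algebra_simps)
  finally have eq: "[:c ^ k * s * r:] - p' = (smult (c ^ k) q + q') * f"
    by simp
  have "degree ([:c ^ k * s * r:] - p') < degree f"
    using p'(2) f_deg by (intro degree_diff_less) simp_all
  \<comment> \<open>Over a domain, a nonzero multiple of \<open>f\<close> cannot have degree below
    that of \<open>f\<close>, so the cofactor vanishes.\<close>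
  then have "smult (c ^ k) q + q' = 0"
    unfolding eq by (metis degree_mult_eq f_deg le_add2 leD degree_0 mult_eq_0_iff less_irrefl)
  then have "[:c ^ k * s * r:] = p'"
    using eq by simp
  then have "c ^ k * s * r \<in> Pw t"
    using p'(3) unfolding coeff_ideal_def by (metis (mono_tags) coeff_pCons_0 mem_Collect_eq)
  moreover have "c ^ k * s \<notin> P"
    using c s P(3) by blast
  ultimately show ?thesis
    using that unfolding Pw_def P_def by blast
qed

theorem theorem3p10:
  fixes m :: "'a::idom poly set" and P :: "'a set"
  assumes "maximalideal m ring_of_type_algebra"
    and "P = contraction m"
  shows "primeideal P ring_of_type_algebra \<and>
    (power_stable m \<longleftrightarrow>
       (\<forall>t\<ge>1. symbolic_power P t = ideal_pow ring_of_type_algebra P t)) \<and>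
    (power_stable m \<longleftrightarrow>
       (\<forall>t\<ge>1. primary_to ring_of_type_algebra P (ideal_pow ring_of_type_algebra P t)))"
proof -
  let ?Pw = "ideal_pow ring_of_type_algebra P"
  have m: "ideal m ring_of_type_algebra"
    using assms(1) by (simp add: maximalideal_def)
  have prime: "primeideal P ring_of_type_algebra"
    unfolding assms(2) using cring.maximalideal_prime[OF cring_from_type_algebra assms(1)]
    by (rule primeideal_contraction)
  \<comment> \<open>Power stability is compared with the cancellation property one exponent at a
    time. Forward, cancellation takes place in the power of \<open>m\<close>; backward, the
    multiplier outside P is cancelled.\<close>
  have "contraction (ideal_pow ring_of_type_algebra m t) = ?Pw t \<longleftrightarrow>
      (\<forall>r s. s \<notin> P \<longrightarrow> s * r \<in> ?Pw t \<longrightarrow> r \<in> ?Pw t)" for t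
  proof
    assume eq: "contraction (ideal_pow ring_of_type_algebra m t) = ?Pw t"
    show "\<forall>r s. s \<notin> P \<longrightarrow> s * r \<in> ?Pw t \<longrightarrow> r \<in> ?Pw t"
    proof (intro allI impI)
      fix r s assume "s \<notin> P" "s * r \<in> ?Pw t"
      then have "s * r \<in> contraction (ideal_pow ring_of_type_algebra m t)"
        unfolding eq by blast
      with \<open>s \<notin> P\<close> have "[:s:] \<notin> m" "[:s:] * [:r:] \<in> ideal_pow ring_of_type_algebra m t"
        unfolding assms(2) contraction_def by (simp_all add: mult.commute)
      then have "[:r:] \<in> ideal_pow ring_of_type_algebra m t"
        by (rule maximalideal_pow_cancel[OF assms(1)])
      then show "r \<in> ?Pw t"
        unfolding eq[symmetric] contraction_def by simp
    qed
  next
    assume "\<forall>r s. s \<notin> P \<longrightarrow> s * r \<in> ?Pw t \<longrightarrow> r \<in> ?Pw t"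
    then show "contraction (ideal_pow ring_of_type_algebra m t) = ?Pw t"
      using ideal_pow_contraction_subset[OF m, of t] contraction_maximalideal_pow[OF assms(1)]
      unfolding assms(2) by blast
  qed
  then have stable: "power_stable m \<longleftrightarrow> (\<forall>t\<ge>1. \<forall>r s. s \<notin> P \<longrightarrow> s * r \<in> ?Pw t \<longrightarrow> r \<in> ?Pw t)"
    unfolding power_stable_def assms(2) by simp
  have "1 \<notin> P"
    using prime by (simp add: primeideal_type_iff)
  \<comment> \<open>The multiplier 1 gives this inclusion; the reverse one is exactly the
    cancellation property.\<close>
  then have "?Pw t \<subseteq> symbolic_power P t" for t
    unfolding symbolic_power_eq[OF prime] by (auto intro: exI[of _ 1])
  then have "symbolic_power P t = ?Pw t \<longleftrightarrow> (\<forall>r s. s \<notin> P \<longrightarrow> s * r \<in> ?Pw t \<longrightarrow> r \<in> ?Pw t)" for t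
    unfolding symbolic_power_eq[OF prime] by blast
  then show ?thesis
    using prime stable primary_to_ideal_pow_iff[OF prime] by simp
qed

end
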